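(* If $\mathcal{H}$ is a set of ordered sets such that the duplications of the elements of $\mathcal{H}$ are representable, then the elements of $\mathcal{S}(\mathcal{H})$ are also representable.
   Context: "Ordered set" means linearly ordered set. Two ordered sets are similar if there is an order preserving bijection between them. Real valued functions are partially ordered pointwise: $f\le g$ iff $f(x)\le g(x)$ for all $x$. An ordered set is representable if it is similar to a set of Baire 1 functions $\mathbb{R}\to\mathbb{R}$ that is linearly ordered by the pointwise ordering; an order type is representable if some (equivalently every) ordered set of that type is. The duplication of an ordered set $X$ is $X\times\{0,1\}$ with the lexicographical ordering. Replacing the points of an ordered set $X$ by ordered sets $Y_x$ $(x\in X)$ means forming $\{(x,y):x\in X,\ y\in Y_x\}$ with the lexicographical ordering. Given a set $\mathcal{H}$ of ordered sets, define a transfinite sequence $S_\alpha$ ($\alpha$ an ordinal): $S_0=\mathcal{H}\cup\{\emptyset\}$, and for $\alpha>0$, $S_\alpha$ is the set of ordered sets that can be obtained by replacing the points of some $X\in\bigcup_{\beta<\alpha}S_\beta$ by sets $Y_x\in\bigcup_{\beta<\alpha}S_\beta$ $(x\in X)$. $\mathcal{S}(\mathcal{H})$ denotes the set of order types of the elements of $\bigcup_{\alpha}S_\alpha$, the union being over all ordinals $\alpha$. *)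

theory Defs
  imports Complex_Main
begin

text \<open>
  An ordered set is a reflexive linear order \<^term>\<open>r\<close>, i.e. a relation with
  \<^term>\<open>Linear_order r\<close>; its set of points is \<^term>\<open>Field r\<close>.
\<close>

definition similar :: "'a rel \<Rightarrow> 'b rel \<Rightarrow> bool" where
  "similar r s \<longleftrightarrow>
    (\<exists>f. bij_betw f (Field r) (Field s) \<and>
         (\<forall>x\<in>Field r. \<forall>y\<in>Field r. (x, y) \<in> r \<longleftrightarrow> (f x, f y) \<in> s))"

definition baire1 :: "(real \<Rightarrow> real) \<Rightarrow> bool" where
  "baire1 f \<longleftrightarrow>
    (\<exists>F :: nat \<Rightarrow> real \<Rightarrow> real.
       (\<forall>n. continuous_on UNIV (F n)) \<and> (\<forall>x. (\<lambda>n. F n x) \<longlonglongrightarrow> f x))"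

text \<open>On functions, \<open>\<le>\<close> is the pointwise order.\<close>

definition pointwise_order :: "(real \<Rightarrow> real) set \<Rightarrow> (real \<Rightarrow> real) rel" where
  "pointwise_order F = {(f, g). f \<in> F \<and> g \<in> F \<and> f \<le> g}"

definition representable :: "'a rel \<Rightarrow> bool" where
  "representable r \<longleftrightarrow>
    (\<exists>F. (\<forall>f\<in>F. baire1 f) \<and> linear_order_on F (pointwise_order F) \<and>
         similar r (pointwise_order F))"

text \<open>
  The order type of \<^term>\<open>r\<close> is its similarity class among the ordered sets with points in
  the same HOL type.
\<close>

definition order_type :: "'a rel \<Rightarrow> 'a rel set" where
  "order_type r = {s. Linear_order s \<and> similar s r}"

definition representable_type :: "'a rel set \<Rightarrow> bool" where
  "representable_type T \<longleftrightarrow> (\<exists>r\<in>T. representable r)"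

definition lex_replace :: "'a rel \<Rightarrow> ('a \<Rightarrow> 'b rel) \<Rightarrow> ('a \<times> 'b) rel" where
  "lex_replace X Y =
    {((x, y), (x', y')). x \<in> Field X \<and> y \<in> Field (Y x) \<and> x' \<in> Field X \<and> y' \<in> Field (Y x') \<and>
       ((x \<noteq> x' \<and> (x, x') \<in> X) \<or> (x = x' \<and> (y, y') \<in> Y x))}"

definition duplication :: "'a rel \<Rightarrow> ('a \<times> nat) rel" where
  "duplication X = lex_replace X (\<lambda>x. {(i, j). i \<le> j \<and> j \<le> 1})"

text \<open>
  Replacing points can be iterated transfinitely, and each step forms pairs.  The type below
  is closed under pairing and contains a copy of \<^typ>\<open>'a\<close>, so that all stages live in one type.
\<close>

datatype 'a point = Base 'a | Pt "'a point" "'a point"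

definition replace_points ::
    "'a point rel \<Rightarrow> ('a point \<Rightarrow> 'a point rel) \<Rightarrow> 'a point rel" where
  "replace_points X Y = dir_image (lex_replace X Y) (\<lambda>(x, y). Pt x y)"

text \<open>
  Ordinals are represented by well-orders \<open>\<alpha>\<close> on a type \<^typ>\<open>'i\<close>, compared by \<open><o\<close>;
  the ordinal zero is the empty relation.  (A relation \<open>\<alpha>\<close> that is not a well-order is
  never \<open><o\<close>-comparable, and is excluded in \<open>S_types\<close>.)
\<close>

function S_stage :: "'a rel set \<Rightarrow> 'i rel \<Rightarrow> 'a point rel set" where
  "S_stage H \<alpha> =
    (if \<alpha> = {} then insert {} ((\<lambda>X. dir_image X Base) ` H)
     else {replace_points X Y | X Y.
             X \<in> (\<Union>\<beta>\<in>{\<beta>. (\<beta>, \<alpha>) \<in> ordLess}. S_stage H \<beta>) \<and>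
             (\<forall>x\<in>Field X. Y x \<in> (\<Union>\<beta>\<in>{\<beta>. (\<beta>, \<alpha>) \<in> ordLess}. S_stage H \<beta>))})"
  by pat_completeness auto
termination
  by (relation "inv_image ordLess snd") (auto simp: wf_ordLess)

text \<open>
  The union ranges over all ordinals that occur as the type of a well-order of a subset of
  \<^typ>\<open>'i\<close>.  No single HOL type carries all ordinals, so \<^typ>\<open>'i\<close> is a parameter; a statement
  about all ordinals is one that holds for arbitrary \<^typ>\<open>'i\<close>.
\<close>

definition S_types :: "'i itself \<Rightarrow> 'a rel set \<Rightarrow> 'a point rel set set" where
  "S_types _ H = order_type ` (\<Union>\<alpha>\<in>{\<alpha> :: 'i rel. Well_order \<alpha>}. S_stage H \<alpha>)"

end

theory Submission
  imports Defs "HOL-Analysis.Uniform_Limit"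
begin

text \<open>
  An ordered set embeds in its duplication, so it is enough to show that the duplication of
  every ordered set in every stage is representable. As the duplication of a replacement of the
  points of \<open>X\<close> by sets \<open>Y x\<close> embeds in the replacement of the points of \<open>X\<close> by the duplications
  of the \<open>Y x\<close>, transfinite induction reduces this to one claim (\<open>representable_lex_replace\<close>):
  if the duplication of \<open>X\<close> and all \<open>Y x\<close> are representable, then so is the replacement of the
  points of \<open>X\<close> by the \<open>Y x\<close>.

  Let \<open>f\<^sub>0\<close> and \<open>f\<^sub>1\<close> be the functions that represent the two copies of a point \<open>x\<close>, so that
  \<open>f\<^sub>0 \<le> f\<^sub>1\<close> and \<open>f\<^sub>0 \<noteq> f\<^sub>1\<close>. The set \<open>Y x\<close> has to fit between them, but they may differ at a
  single point only. This is remedied by a second variable: if \<open>h\<close> represents \<open>y\<close> and has values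
  in \<open>[0, 1]\<close>, then let the pair \<open>(x, y)\<close> correspond to the function \<open>(s, t) \<mapsto> f\<^sub>0 s + (f\<^sub>1 s -
  f\<^sub>0 s) * h t\<close> of two variables. Wherever \<open>f\<^sub>0 s < f\<^sub>1 s\<close>, the section at \<open>s\<close> is a positively
  rescaled copy of \<open>h\<close>. Composition with a continuous surjection from the line to the plane
  preserves Baire class 1, the pointwise order and distinctness, and leads back to functions of
  one variable. The surjection used here is Schoenberg's plane-filling curve
  (\<open>continuous_plane_filling_curve\<close>).
\<close>

section \<open>A continuous surjection from the line to the plane\<close>

text \<open>The distance from \<open>t\<close> to the nearest even integer.\<close>

definition tent :: "real \<Rightarrow> real" where
  "tent t = arccos (cos (pi * t)) / pi"

lemma tent_add_even:
  assumes "0 \<le> s" "s \<le> 1"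
  shows "tent (s + 2 * real m) = s"
proof -
  have "cos (pi * (s + 2 * real m)) = cos (pi * s + 2 * real m * pi)"
    by (simp add: algebra_simps)
  also have "\<dots> = cos (pi * s)"
    using cos_2npi[of m] sin_2npi[of m] by (simp add: cos_add mult.assoc)
  finally show ?thesis
    using assms by (simp add: tent_def arccos_cos mult_left_le)
qed

lemma continuous_on_tent [continuous_intros]:
  fixes S :: "real set"
  assumes "continuous_on S g"
  shows "continuous_on S (\<lambda>x. tent (g x))"
proof -
  have "continuous_on S (\<lambda>x. cos (pi * g x))"
    by (intro continuous_on_cos continuous_on_mult continuous_on_const assms)
  then show ?thesis
    unfolding tent_def by (intro continuous_on_divide continuous_on_arccos continuous_on_const) auto
qed

text \<open>
  A continuous function of period 2 that is 0 on \<open>[0, 1/3]\<close> and 1 on \<open>[2/3, 1]\<close>.  On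
  the Cantor set it reads off whether the first ternary digit is 0 or 2.
\<close>

definition digit :: "real \<Rightarrow> real" where
  "digit t = max 0 (min 1 (3 * tent t - 1))"

lemma digit_eq_0: "0 \<le> s \<Longrightarrow> s \<le> 1/3 \<Longrightarrow> digit (s + 2 * real m) = 0"
  by (simp add: digit_def tent_add_even)

lemma digit_eq_1: "2/3 \<le> s \<Longrightarrow> s \<le> 1 \<Longrightarrow> digit (s + 2 * real m) = 1"
  by (simp add: digit_def tent_add_even)

lemma digit_bounds: "0 \<le> digit t" "digit t \<le> 1"
  by (auto simp: digit_def)

lemma continuous_on_digit [continuous_intros]:
  fixes S :: "real set"
  shows "continuous_on S g \<Longrightarrow> continuous_on S (\<lambda>x. digit (g x))"
  unfolding digit_def by (intro continuous_intros)

text \<open>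
  Every sequence of zeros and ones is read off by \<^const>\<open>digit\<close> from some number in \<open>[0, 1]\<close>, a
  point of the Cantor set.  The same holds for its translates by even integers.
\<close>

lemma exists_prescribed_digits:
  fixes c :: "nat \<Rightarrow> nat"
  assumes c: "\<And>k. c k \<le> 1"
  obtains t where "0 \<le> t" "t \<le> 1"
    "\<And>k m. digit (3 ^ k * (t + 2 * real m)) = real (c k)"
proof -
  define T where "T k = (\<Sum>j. 2 * real (c (j + k)) / 3 ^ Suc j)" for k
  have geo: "(\<lambda>j. 2 / 3 ^ Suc j :: real) sums 1"
    using sums_mult[OF geometric_sums[of "1/3 :: real"], of "2/3"]
    by (simp add: power_divide)
  have bound: "2 * real (c (j + k)) / 3 ^ Suc j \<le> 2 / 3 ^ Suc j" for j k
    using c[of "j + k"] by (intro divide_right_mono) auto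
  have summ: "summable (\<lambda>j. 2 * real (c (j + k)) / 3 ^ Suc j)" for k
    by (rule summable_comparison_test'[OF sums_summable[OF geo]]) (use bound in auto)
  have T_ge: "0 \<le> T k" for k
    unfolding T_def by (rule suminf_nonneg[OF summ]) auto
  have T_le: "T k \<le> 1" for k
    unfolding T_def sums_unique[OF geo]
    by (rule suminf_le[OF bound summ sums_summable[OF geo]])
  have T_step: "3 * T k = 2 * real (c k) + T (Suc k)" for k
  proof -
    have "T k = 2 * real (c k) / 3 + (\<Sum>j. 2 * real (c (Suc j + k)) / 3 ^ Suc (Suc j))"
      unfolding T_def using suminf_split_head[OF summ[of k]] by simp
    also have "(\<Sum>j. 2 * real (c (Suc j + k)) / 3 ^ Suc (Suc j)) = T (Suc k) / 3"
      unfolding T_def using suminf_divide[OF summ[of "Suc k"], of 3]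
      by (simp add: mult.commute)
    finally show ?thesis by simp
  qed
  \<comment> \<open>Multiplication by \<open>3 ^ k\<close> shifts the ternary expansion; the digits that move in front of the
    ternary point are all even, so they add up to an even integer.\<close>
  have shift: "\<exists>N. 3 ^ k * T 0 = T k + 2 * real N" for k
  proof (induction k)
    case (Suc k)
    then obtain N where "3 ^ k * T 0 = T k + 2 * real N" by blast
    then have "3 ^ Suc k * T 0 = T (Suc k) + 2 * real (3 * N + c k)"
      using T_step[of k] by simp
    then show ?case by blast
  qed (auto intro: exI[of _ 0])
  have "digit (3 ^ k * (T 0 + 2 * real m)) = real (c k)" for k m
  proof -
    obtain N where "3 ^ k * T 0 = T k + 2 * real N" using shift by blast
    then have eq: "3 ^ k * (T 0 + 2 * real m) = T k + 2 * real (N + 3 ^ k * m)"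
      by (simp add: algebra_simps)
    show ?thesis
    proof (cases "c k = 0")
      case True
      then show ?thesis
        unfolding eq using T_step[of k] T_ge[of k] T_le[of "Suc k"] by (subst digit_eq_0) auto
    next
      case False
      with c[of k] have "c k = 1" by simp
      then show ?thesis
        unfolding eq using T_step[of k] T_ge[of "Suc k"] T_le[of k] by (subst digit_eq_1) auto
    qed
  qed
  then show thesis using that T_ge T_le by blast
qed

lemma binary_expansion:
  fixes a :: real
  assumes "0 \<le> a" "a < 1"
  obtains c :: "nat \<Rightarrow> nat"
  where "\<And>k. c k \<le> 1" "(\<lambda>k. real (c k) / 2 ^ Suc k) sums a"
proof -
  define c where "c k = nat (\<lfloor>2 ^ Suc k * a\<rfloor> mod 2)" for k
  have c_le: "c k \<le> 1" for k
    unfolding c_def by linarith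
  have fl: "\<lfloor>2 ^ Suc k * a\<rfloor> = 2 * \<lfloor>2 ^ k * a\<rfloor> + int (c k)" for k
  proof -
    have "\<lfloor>2 ^ Suc k * a\<rfloor> div 2 = \<lfloor>2 ^ k * a\<rfloor>"
      using floor_divide_real_eq_div[of 2 "2 ^ Suc k * a"] by simp
    then show ?thesis
      unfolding c_def using mult_div_mod_eq[of 2 "\<lfloor>2 ^ Suc k * a\<rfloor>"] by simp
  qed
  \<comment> \<open>The partial sums are the dyadic approximations of \<open>a\<close> from below; \<open>a < 1\<close> makes the integer
    part vanish.\<close>
  have part: "(\<Sum>k<n. real (c k) / 2 ^ Suc k) = of_int \<lfloor>2 ^ n * a\<rfloor> / 2 ^ n" for n
  proof (induction n)
    case 0
    have "\<lfloor>a\<rfloor> = 0" using assms by linarith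
    then show ?case by simp
  next
    case (Suc n)
    have "(\<Sum>k<Suc n. real (c k) / 2 ^ Suc k)
        = of_int \<lfloor>2 ^ n * a\<rfloor> / 2 ^ n + real (c n) / 2 ^ Suc n"
      using Suc by simp
    also have "\<dots> = of_int \<lfloor>2 ^ Suc n * a\<rfloor> / 2 ^ Suc n"
      unfolding fl by (simp add: field_simps)
    finally show ?case .
  qed
  have "(\<lambda>n. of_int \<lfloor>2 ^ n * a\<rfloor> / 2 ^ n :: real) \<longlonglongrightarrow> a"
  proof (rule tendsto_sandwich[of "\<lambda>n. a - (1/2) ^ n" _ _ "\<lambda>n. a"])
    show "\<forall>\<^sub>F n in sequentially. a - (1/2) ^ n \<le> of_int \<lfloor>2 ^ n * a\<rfloor> / 2 ^ n"
    proof (rule always_eventually, rule allI)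
      fix n
      have "2 ^ n * a - 1 \<le> of_int \<lfloor>2 ^ n * a\<rfloor>" by linarith
      then have "(2 ^ n * a - 1) / 2 ^ n \<le> of_int \<lfloor>2 ^ n * a\<rfloor> / 2 ^ n"
        by (intro divide_right_mono) auto
      then show "a - (1/2) ^ n \<le> of_int \<lfloor>2 ^ n * a\<rfloor> / 2 ^ n"
        by (simp add: field_simps)
    qed
    show "\<forall>\<^sub>F n in sequentially. of_int \<lfloor>2 ^ n * a\<rfloor> / 2 ^ n \<le> a"
      by (auto simp: field_simps)
    have "(\<lambda>n. a - (1/2) ^ n) \<longlonglongrightarrow> a - 0"
      by (intro tendsto_diff tendsto_const LIMSEQ_power_zero) auto
    then show "(\<lambda>n. a - (1/2) ^ n) \<longlonglongrightarrow> a" by simp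
  qed auto
  then have "(\<lambda>k. real (c k) / 2 ^ Suc k) sums a"
    unfolding sums_def part .
  with c_le show thesis by (rule that)
qed

text \<open>
  One coordinate of Schoenberg's curve.  It depends on the numbers \<open>digit (3 ^ k * t)\<close> with even
  \<open>k\<close> only; the other coordinate, \<open>schoenberg (3 * t)\<close>, depends on those with odd \<open>k\<close>.  So the two
  coordinates can be prescribed independently by interleaving binary expansions.
\<close>

definition schoenberg :: "real \<Rightarrow> real" where
  "schoenberg t = (\<Sum>n. digit (3 ^ (2 * n) * t) / 2 ^ Suc n)"

lemma continuous_on_schoenberg: "continuous_on UNIV schoenberg"
proof -
  have "uniform_limit UNIV (\<lambda>n t. \<Sum>i<n. digit (3 ^ (2 * i) * t) / 2 ^ Suc i) schoenberg
      sequentially"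
    unfolding schoenberg_def [abs_def]
  proof (rule Weierstrass_m_test)
    show "norm (digit (3 ^ (2 * n) * t) / 2 ^ Suc n) \<le> (1/2) ^ Suc n" for n t
      using digit_bounds[of "3 ^ (2 * n) * t"] by (simp add: power_divide divide_right_mono)
    show "summable (\<lambda>n. (1/2 :: real) ^ Suc n)"
      by (simp add: summable_geometric)
  qed
  moreover have "\<forall>\<^sub>F n in sequentially. continuous_on UNIV
      (\<lambda>t. \<Sum>i<n. digit (3 ^ (2 * i) * t) / 2 ^ Suc i)"
    by (intro always_eventually allI continuous_intros) auto
  ultimately show ?thesis
    by (intro uniform_limit_theorem[where F = sequentially]) auto
qed

lemma schoenberg_onto_square:
  assumes "0 \<le> a" "a < 1" "0 \<le> b" "b < 1"
  obtains t where "0 \<le> t" "t \<le> 1"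
    "\<And>m. schoenberg (t + 2 * real m) = a" "\<And>m. schoenberg (3 * (t + 2 * real m)) = b"
proof -
  obtain c where c: "\<And>k. c k \<le> (1::nat)" "(\<lambda>k. real (c k) / 2 ^ Suc k) sums a"
    using binary_expansion assms by metis
  obtain d where d: "\<And>k. d k \<le> (1::nat)" "(\<lambda>k. real (d k) / 2 ^ Suc k) sums b"
    using binary_expansion assms by metis
  define e where "e k = (if even k then c (k div 2) else d (k div 2))" for k
  have "e k \<le> 1" for k using c d by (simp add: e_def)
  then obtain t where t: "0 \<le> t" "t \<le> 1"
      "\<And>k m. digit (3 ^ k * (t + 2 * real m)) = real (e k)"
    using exists_prescribed_digits[of e] by metis
  have "schoenberg (t + 2 * real m) = a" for m
    unfolding schoenberg_def t(3) using sums_unique[OF c(2)] by (simp add: e_def)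
  moreover have "schoenberg (3 * (t + 2 * real m)) = b" for m
  proof -
    have "digit (3 ^ (2 * n) * (3 * (t + 2 * real m))) = real (d n)" for n
    proof -
      have "3 ^ (2 * n) * (3 * (t + 2 * real m)) = 3 ^ Suc (2 * n) * (t + 2 * real m)"
        by simp
      then show ?thesis by (simp only: t(3)) (simp add: e_def)
    qed
    then show ?thesis unfolding schoenberg_def using sums_unique[OF d(2)] by simp
  qed
  ultimately show thesis using that t by blast
qed

text \<open>
  The curve \<open>(schoenberg t, schoenberg (3 * t))\<close> covers the unit square again on each interval
  \<open>[2 * m, 2 * m + 1]\<close>.  The factor \<open>t - tent t\<close> is continuous and has the constant value
  \<open>2 * m\<close> there, so it stretches the square to squares of arbitrary size.
\<close>

lemma continuous_plane_filling_curve: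
  "\<exists>(u :: real \<Rightarrow> real) (v :: real \<Rightarrow> real). continuous_on UNIV u \<and> continuous_on UNIV v \<and>
    (\<forall>a b. \<exists>t. u t = a \<and> v t = b)"
proof -
  define u where "u t = (t - tent t) * (2 * schoenberg t - 1)" for t
  define v where "v t = (t - tent t) * (2 * schoenberg (3 * t) - 1)" for t
  have u: "continuous_on UNIV u"
    unfolding u_def by (intro continuous_intros continuous_on_schoenberg)
  have "continuous_on UNIV (\<lambda>t. schoenberg (3 * t))"
    by (intro continuous_on_compose2[OF continuous_on_schoenberg] continuous_intros) auto
  then have v: "continuous_on UNIV v"
    unfolding v_def by (intro continuous_intros)
  have onto: "\<exists>t. u t = a \<and> v t = b" for a b :: real
  proof -
    obtain m :: nat where "\<bar>a\<bar> + \<bar>b\<bar> < real m"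
      using reals_Archimedean2 by blast
    then have m: "\<bar>a\<bar> < real m" "\<bar>b\<bar> < real m" "0 < real m" by linarith+
    define a' where "a' = (a / (2 * real m) + 1) / 2"
    define b' where "b' = (b / (2 * real m) + 1) / 2"
    have "0 \<le> a'" "a' < 1" "0 \<le> b'" "b' < 1"
      using m unfolding a'_def b'_def by (auto simp: field_simps abs_less_iff)
    then obtain t where t: "0 \<le> t" "t \<le> 1"
        "schoenberg (t + 2 * real m) = a'" "schoenberg (3 * (t + 2 * real m)) = b'"
      using schoenberg_onto_square by metis
    then have "u (t + 2 * real m) = 2 * real m * (2 * a' - 1)"
        "v (t + 2 * real m) = 2 * real m * (2 * b' - 1)"
      by (simp_all only: u_def v_def tent_add_even) simp_all
    moreover have "2 * real m * (2 * a' - 1) = a" "2 * real m * (2 * b' - 1) = b"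
      using m(3) by (simp_all add: a'_def b'_def field_simps)
    ultimately have "u (t + 2 * real m) = a" "v (t + 2 * real m) = b"
      by simp_all
    then show ?thesis by blast
  qed
  show ?thesis
    using u v onto by blast
qed

section \<open>Baire 1 functions\<close>

lemma baire1_compose_continuous:
  assumes "baire1 f" "continuous_on UNIV g"
  shows "baire1 (\<lambda>x. f (g x))"
proof -
  obtain F where F: "\<And>n. continuous_on UNIV (F n)" "\<And>x. (\<lambda>n. F n x) \<longlonglongrightarrow> f x"
    using assms(1) unfolding baire1_def by blast
  have "continuous_on UNIV (\<lambda>x. F n (g x))" for n
    by (rule continuous_on_compose2[OF F(1) assms(2)]) auto
  then show ?thesis
    unfolding baire1_def using F(2) by (intro exI[of _ "\<lambda>n x. F n (g x)"]) blast
qed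

lemma continuous_compose_baire1_2:
  fixes c :: "real \<times> real \<Rightarrow> real"
  assumes c: "continuous_on UNIV c" and "baire1 f" "baire1 g"
  shows "baire1 (\<lambda>x. c (f x, g x))"
proof -
  obtain F where F: "\<And>n. continuous_on UNIV (F n)" "\<And>x. (\<lambda>n. F n x) \<longlonglongrightarrow> f x"
    using assms(2) unfolding baire1_def by blast
  obtain G where G: "\<And>n. continuous_on UNIV (G n)" "\<And>x. (\<lambda>n. G n x) \<longlonglongrightarrow> g x"
    using assms(3) unfolding baire1_def by blast
  have "continuous_on UNIV (\<lambda>x. c (F n x, G n x))" for n
    by (rule continuous_on_compose2[OF c continuous_on_Pair[OF F(1) G(1)]]) auto
  moreover have "(\<lambda>n. c (F n x, G n x)) \<longlonglongrightarrow> c (f x, g x)" for x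
    by (rule continuous_on_tendsto_compose[OF c tendsto_Pair[OF F(2) G(2)]]) auto
  ultimately show ?thesis
    unfolding baire1_def by (intro exI[of _ "\<lambda>n x. c (F n x, G n x)"]) blast
qed

lemma baire1_add: "baire1 f \<Longrightarrow> baire1 g \<Longrightarrow> baire1 (\<lambda>x. f x + g x)"
  using continuous_compose_baire1_2[of "\<lambda>p. fst p + snd p"] by (simp add: continuous_intros)

lemma baire1_diff: "baire1 f \<Longrightarrow> baire1 g \<Longrightarrow> baire1 (\<lambda>x. f x - g x)"
  using continuous_compose_baire1_2[of "\<lambda>p. fst p - snd p"] by (simp add: continuous_intros)

lemma baire1_mult: "baire1 f \<Longrightarrow> baire1 g \<Longrightarrow> baire1 (\<lambda>x. f x * g x)"
  using continuous_compose_baire1_2[of "\<lambda>p. fst p * snd p"] by (simp add: continuous_intros)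

lemma continuous_compose_baire1:
  assumes "continuous_on UNIV g" "baire1 f"
  shows "baire1 (\<lambda>x. g (f x))"
proof -
  have "continuous_on UNIV (\<lambda>p :: real \<times> real. g (fst p))"
    by (rule continuous_on_compose2[OF assms(1)]) (auto intro: continuous_intros)
  from continuous_compose_baire1_2[OF this assms(2,2)] show ?thesis by simp
qed

section \<open>Representations as injective monotone maps\<close>

lemma Linear_orderI:
  assumes "\<And>x. x \<in> Field r \<Longrightarrow> (x, x) \<in> r"
    and "\<And>x y z. (x, y) \<in> r \<Longrightarrow> (y, z) \<in> r \<Longrightarrow> (x, z) \<in> r"
    and "\<And>x y. (x, y) \<in> r \<Longrightarrow> (y, x) \<in> r \<Longrightarrow> x = y"
    and "\<And>x y. x \<in> Field r \<Longrightarrow> y \<in> Field r \<Longrightarrow> x \<noteq> y \<Longrightarrow> (x, y) \<in> r \<or> (y, x) \<in> r"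
  shows "Linear_order r"
  unfolding order_on_defs total_on_def
  using assms by (auto intro!: refl_onI transI antisymI intro: FieldI1 FieldI2)

lemma Linear_orderD:
  assumes "Linear_order r"
  shows "\<And>x. x \<in> Field r \<Longrightarrow> (x, x) \<in> r"
    and "\<And>x y z. (x, y) \<in> r \<Longrightarrow> (y, z) \<in> r \<Longrightarrow> (x, z) \<in> r"
    and "\<And>x y. (x, y) \<in> r \<Longrightarrow> (y, x) \<in> r \<Longrightarrow> x = y"
    and "\<And>x y. x \<in> Field r \<Longrightarrow> y \<in> Field r \<Longrightarrow> x \<noteq> y \<Longrightarrow> (x, y) \<in> r \<or> (y, x) \<in> r"
  using assms unfolding order_on_defs total_on_def refl_on_def
  by (auto dest: transD antisymD)

lemma Field_pointwise_order [simp]: "Field (pointwise_order F) = F"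
  unfolding pointwise_order_def Field_def by auto

lemma similar_Linear_order:
  assumes "similar r s" "Linear_order s"
  shows "Linear_order r"
proof -
  obtain f where f: "inj_on f (Field r)" "\<And>x. x \<in> Field r \<Longrightarrow> f x \<in> Field s"
      "\<And>x y. x \<in> Field r \<Longrightarrow> y \<in> Field r \<Longrightarrow> (x, y) \<in> r \<longleftrightarrow> (f x, f y) \<in> s"
    using assms(1) unfolding similar_def bij_betw_def by blast
  note s = Linear_orderD[OF assms(2)]
  show ?thesis
  proof (rule Linear_orderI)
    show "(x, z) \<in> r" if "(x, y) \<in> r" "(y, z) \<in> r" for x y z
      using that f(3) s(2) by (meson FieldI1 FieldI2)
    show "x = y" if "(x, y) \<in> r" "(y, x) \<in> r" for x y
      using that f(1,3) s(3) by (meson FieldI1 FieldI2 inj_onD)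
    show "(x, y) \<in> r \<or> (y, x) \<in> r" if "x \<in> Field r" "y \<in> Field r" "x \<noteq> y" for x y
      using that f s(4) by (meson inj_onD)
  qed (use f s(1) in blast)
qed

text \<open>
  Between linear orders, an injective monotone map is an order isomorphism onto its image, so the
  converse implication of monotonicity need not be checked.
\<close>

lemma representable_iff:
  "representable r \<longleftrightarrow> Linear_order r \<and>
    (\<exists>\<phi>. (\<forall>x\<in>Field r. baire1 (\<phi> x)) \<and> inj_on \<phi> (Field r) \<and> (\<forall>(x, y)\<in>r. \<phi> x \<le> \<phi> y))"
proof (rule iffI)
  assume "representable r"
  then obtain F where F: "\<forall>f\<in>F. baire1 f" "Linear_order (pointwise_order F)"
      "similar r (pointwise_order F)"
    unfolding representable_def by auto
  obtain f where f: "bij_betw f (Field r) F"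
      "\<And>x y. x \<in> Field r \<Longrightarrow> y \<in> Field r \<Longrightarrow> (x, y) \<in> r \<longleftrightarrow> (f x, f y) \<in> pointwise_order F"
    using F(3) unfolding similar_def by auto
  have "f x \<le> f y" if "(x, y) \<in> r" for x y
    using that f(2)[of x y] by (auto simp: pointwise_order_def FieldI1 FieldI2)
  moreover have "\<forall>x\<in>Field r. baire1 (f x)"
    using F(1) f(1) bij_betwE by blast
  ultimately show "Linear_order r \<and>
      (\<exists>\<phi>. (\<forall>x\<in>Field r. baire1 (\<phi> x)) \<and> inj_on \<phi> (Field r) \<and> (\<forall>(x, y)\<in>r. \<phi> x \<le> \<phi> y))"
    using similar_Linear_order[OF F(3,2)] f(1) by (auto simp: bij_betw_def)
next
  assume "Linear_order r \<and>
    (\<exists>\<phi>. (\<forall>x\<in>Field r. baire1 (\<phi> x)) \<and> inj_on \<phi> (Field r) \<and> (\<forall>(x, y)\<in>r. \<phi> x \<le> \<phi> y))"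
  then obtain \<phi> where r: "Linear_order r" and b: "\<forall>x\<in>Field r. baire1 (\<phi> x)"
    and inj: "inj_on \<phi> (Field r)" and mono: "\<forall>(x, y)\<in>r. \<phi> x \<le> \<phi> y"
    by blast
  let ?F = "\<phi> ` Field r"
  have iff: "(x, y) \<in> r \<longleftrightarrow> \<phi> x \<le> \<phi> y" if xy: "x \<in> Field r" "y \<in> Field r" for x y
  proof
    assume le: "\<phi> x \<le> \<phi> y"
    show "(x, y) \<in> r"
    proof (rule ccontr)
      assume not: "(x, y) \<notin> r"
      then have "(y, x) \<in> r" and "x \<noteq> y"
        using Linear_orderD(1,4)[OF r] xy by blast+
      then have "\<phi> x = \<phi> y" using mono le by (auto intro: antisym)
      with inj xy \<open>x \<noteq> y\<close> show False by (auto dest: inj_onD)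
    qed
  qed (use mono in auto)
  have "similar r (pointwise_order ?F)"
    unfolding similar_def Field_pointwise_order
    by (rule exI[of _ \<phi>]) (simp add: bij_betw_def inj iff pointwise_order_def)
  moreover have "Linear_order (pointwise_order ?F)"
  proof (rule Linear_orderI)
    show "(f, g) \<in> pointwise_order ?F \<or> (g, f) \<in> pointwise_order ?F"
      if "f \<in> Field (pointwise_order ?F)" "g \<in> Field (pointwise_order ?F)" "f \<noteq> g" for f g
    proof -
      from that obtain x y where "x \<in> Field r" "y \<in> Field r" "f = \<phi> x" "g = \<phi> y"
        by auto
      then show ?thesis
        using that(3) Linear_orderD(4)[OF r, of x y] iff by (auto simp: pointwise_order_def)
    qed
  qed (unfold Field_pointwise_order, auto simp: pointwise_order_def intro: order_trans)
  ultimately show "representable r"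
    unfolding representable_def using b by (intro exI[of _ ?F]) auto
qed

lemma representable_inj_mono:
  assumes "representable s" "Linear_order r" "g ` Field r \<subseteq> Field s" "inj_on g (Field r)"
    and "\<And>x y. (x, y) \<in> r \<Longrightarrow> (g x, g y) \<in> s"
  shows "representable r"
proof -
  obtain \<phi> where \<phi>: "\<forall>x\<in>Field s. baire1 (\<phi> x)" "inj_on \<phi> (Field s)" "\<forall>(x, y)\<in>s. \<phi> x \<le> \<phi> y"
    using assms(1) unfolding representable_iff by blast
  have "\<forall>x\<in>Field r. baire1 ((\<phi> \<circ> g) x)"
    using \<phi>(1) assms(3) by auto
  moreover have "inj_on (\<phi> \<circ> g) (Field r)"
    using assms(4) inj_on_subset[OF \<phi>(2) assms(3)] by (rule comp_inj_on)
  moreover have "\<forall>(x, y)\<in>r. (\<phi> \<circ> g) x \<le> (\<phi> \<circ> g) y"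
    using \<phi>(3) assms(5) by auto
  ultimately show ?thesis
    unfolding representable_iff using assms(2) by blast
qed

text \<open>A strictly increasing continuous map of the line into \<open>[0, 1]\<close> bounds any representation.\<close>

lemma representable_bounded:
  assumes "representable r"
  shows "\<exists>\<phi>. (\<forall>x\<in>Field r. baire1 (\<phi> x)) \<and> inj_on \<phi> (Field r) \<and>
    (\<forall>(x, y)\<in>r. \<phi> x \<le> \<phi> y) \<and> (\<forall>x t. 0 \<le> \<phi> x t \<and> \<phi> x t \<le> 1)"
proof -
  obtain \<phi> where \<phi>: "\<forall>x\<in>Field r. baire1 (\<phi> x)" "inj_on \<phi> (Field r)" "\<forall>(x, y)\<in>r. \<phi> x \<le> \<phi> y"
    using assms unfolding representable_iff by blast
  define q where "q s = arctan s / pi + 1 / 2" for s :: real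
  have q: "0 \<le> q s" "q s \<le> 1" for s
    using arctan_bounded[of s] by (auto simp: q_def field_simps)
  have q_le: "q s \<le> q t \<longleftrightarrow> s \<le> t" for s t
    by (simp add: q_def divide_le_cancel arctan_le_iff)
  then have q_eq: "q s = q t \<longleftrightarrow> s = t" for s t
    by (metis order_antisym order_refl)
  have "continuous_on UNIV q"
    unfolding q_def by (intro continuous_intros) auto
  then have "baire1 (\<lambda>t. q (\<phi> x t))" if "x \<in> Field r" for x
    using \<phi>(1) that continuous_compose_baire1 by blast
  moreover have "inj_on (\<lambda>x t. q (\<phi> x t)) (Field r)"
    using \<phi>(2) by (auto simp: inj_on_def fun_eq_iff q_eq)
  moreover have "(\<lambda>t. q (\<phi> x t)) \<le> (\<lambda>t. q (\<phi> y t))" if "(x, y) \<in> r" for x y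
    using \<phi>(3) that by (auto simp: le_fun_def q_le)
  ultimately show ?thesis using q by (intro exI[of _ "\<lambda>x t. q (\<phi> x t)"]) auto
qed

section \<open>Lexicographical replacements\<close>

lemma Field_lex_replace:
  assumes "\<And>x. x \<in> Field X \<Longrightarrow> Linear_order (Y x)"
  shows "Field (lex_replace X Y) = (SIGMA x:Field X. Field (Y x))"
proof
  show "Field (lex_replace X Y) \<subseteq> (SIGMA x:Field X. Field (Y x))"
    by (auto simp: lex_replace_def Field_def)
  have "((x, y), (x, y)) \<in> lex_replace X Y" if "x \<in> Field X" "y \<in> Field (Y x)" for x y
    using that Linear_orderD(1)[OF assms] by (auto simp: lex_replace_def)
  then show "(SIGMA x:Field X. Field (Y x)) \<subseteq> Field (lex_replace X Y)"
    by (auto intro: FieldI1)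
qed

lemma Linear_order_lex_replace:
  assumes X: "Linear_order X" and Y: "\<And>x. x \<in> Field X \<Longrightarrow> Linear_order (Y x)"
  shows "Linear_order (lex_replace X Y)"
proof (rule Linear_orderI)
  note F = Field_lex_replace[of X Y, OF Y, simplified]
  note DX = Linear_orderD[OF X]
  note DY = Linear_orderD[OF Y]
  show "(p, p) \<in> lex_replace X Y" if "p \<in> Field (lex_replace X Y)" for p
    using that DY(1) unfolding F by (auto simp: lex_replace_def)
  show "(p, s) \<in> lex_replace X Y"
    if "(p, q) \<in> lex_replace X Y" "(q, s) \<in> lex_replace X Y" for p q s
    using that unfolding lex_replace_def by (auto dest: DX(2) DX(3) intro: DY(2))
  show "p = q" if "(p, q) \<in> lex_replace X Y" "(q, p) \<in> lex_replace X Y" for p q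
    using that unfolding lex_replace_def by (auto dest: DX(3) DY(3))
  show "(p, q) \<in> lex_replace X Y \<or> (q, p) \<in> lex_replace X Y"
    if "p \<in> Field (lex_replace X Y)" "q \<in> Field (lex_replace X Y)" "p \<noteq> q" for p q
    using that DX(4) DY(4) unfolding F by (fastforce simp: lex_replace_def)
qed

lemma Field_two: "Field {(i, j). i \<le> j \<and> j \<le> (1::nat)} = {0, 1}"
  by (auto simp: Field_def)

lemma Linear_order_two: "Linear_order {(i, j). i \<le> j \<and> j \<le> (1::nat)}"
  by (rule Linear_orderI) (unfold Field_two, auto)

lemma Field_duplication: "Field (duplication X) = Field X \<times> {0, 1}"
  unfolding duplication_def Field_lex_replace[OF Linear_order_two] Field_two ..

lemma Linear_order_duplication: "Linear_order X \<Longrightarrow> Linear_order (duplication X)"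
  unfolding duplication_def by (rule Linear_order_lex_replace[OF _ Linear_order_two])

lemma in_duplication_iff:
  "((x, i), (y, j)) \<in> duplication X \<longleftrightarrow> x \<in> Field X \<and> y \<in> Field X \<and> i \<le> 1 \<and> j \<le> 1 \<and>
    (x \<noteq> y \<and> (x, y) \<in> X \<or> x = y \<and> i \<le> j)"
  unfolding duplication_def lex_replace_def Field_two by auto

lemma representable_of_duplication:
  assumes "Linear_order X" "representable (duplication X)"
  shows "representable X"
proof (rule representable_inj_mono[OF assms(2,1), where g = "\<lambda>x. (x, 0)"])
  show "((x, 0), (y, 0)) \<in> duplication X" if "(x, y) \<in> X" for x y
    using that by (auto simp: in_duplication_iff FieldI1 FieldI2)
qed (auto simp: Field_duplication inj_on_def)

text \<open>
  The two copies of \<open>x\<close> leave room for \<open>Y x\<close>: the functions that represent the points of \<open>Y x\<close>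
  interpolate, in a second variable, between those that represent the two copies.
\<close>

lemma representable_lex_replace:
  assumes X: "Linear_order X" and dup: "representable (duplication X)"
    and Y: "\<And>x. x \<in> Field X \<Longrightarrow> representable (Y x)"
  shows "representable (lex_replace X Y)"
proof -
  have YL: "Linear_order (Y x)" if "x \<in> Field X" for x
    using Y[OF that] unfolding representable_iff by blast
  note F = Field_lex_replace[of X Y, OF YL, simplified]
  obtain f where f: "\<forall>p\<in>Field (duplication X). baire1 (f p)" "inj_on f (Field (duplication X))"
      "\<forall>(p, q)\<in>duplication X. f p \<le> f q"
    using dup unfolding representable_iff by blast
  have "\<forall>x\<in>Field X. \<exists>h. (\<forall>y\<in>Field (Y x). baire1 (h y)) \<and> inj_on h (Field (Y x)) \<and>
      (\<forall>(y, z)\<in>Y x. h y \<le> h z) \<and> (\<forall>y t. 0 \<le> h y t \<and> h y t \<le> 1)"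
    using Y by (intro ballI representable_bounded)
  from bchoice[OF this] obtain h where h: "\<forall>x\<in>Field X. (\<forall>y\<in>Field (Y x). baire1 (h x y)) \<and>
      inj_on (h x) (Field (Y x)) \<and> (\<forall>(y, z)\<in>Y x. h x y \<le> h x z) \<and>
      (\<forall>y t. 0 \<le> h x y t \<and> h x y t \<le> 1)"
    by (elim exE)
  have h_baire1: "baire1 (h x y)" if "x \<in> Field X" "y \<in> Field (Y x)" for x y
    using bspec[OF h that(1)] that(2) by blast
  have h_inj: "inj_on (h x) (Field (Y x))" if "x \<in> Field X" for x
    using bspec[OF h that] by blast
  have h_mono: "h x y \<le> h x z" if "x \<in> Field X" "(y, z) \<in> Y x" for x y z
    using bspec[OF h that(1)] that(2) by blast
  have h_bounds: "0 \<le> h x y t" "h x y t \<le> 1" if "x \<in> Field X" for x y t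
    using bspec[OF h that] by blast+
  obtain u v :: "real \<Rightarrow> real" where u: "continuous_on UNIV u" and v: "continuous_on UNIV v"
      and onto: "\<And>a b. \<exists>t. u t = a \<and> v t = b"
    using continuous_plane_filling_curve by auto
  define G where
    "G = (\<lambda>(x, y) t. f (x, 0) (u t) + (f (x, 1) (u t) - f (x, 0) (u t)) * h x y (v t))"
  have f01: "f (x, 0) s \<le> f (x, 1) s" if "x \<in> Field X" for x s
    using f(3) that by (force simp: in_duplication_iff le_fun_def)
  have f10: "f (x, 1) s \<le> f (x', 0) s" if "(x, x') \<in> X" "x \<noteq> x'" for x x' s
    using f(3) that by (force simp: in_duplication_iff le_fun_def FieldI1 FieldI2)
  have G_ge: "f (x, 0) (u t) \<le> G (x, y) t" if "x \<in> Field X" for x y t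
    using f01[OF that] h_bounds(1)[OF that] by (simp add: G_def)
  have G_le: "G (x, y) t \<le> f (x, 1) (u t)" if "x \<in> Field X" for x y t
    using f01[OF that]
      mult_left_le[OF h_bounds(2)[OF that], of "f (x, 1) (u t) - f (x, 0) (u t)" y "v t"]
    by (simp add: G_def)
  have G_same: "G (x, y) t \<le> G (x, z) t" if "x \<in> Field X" "(y, z) \<in> Y x" for x y z t
    using f01[OF that(1)] h_mono[OF that] by (auto simp: G_def le_fun_def intro!: mult_left_mono)
  have G_baire1: "baire1 (G (x, y))" if "x \<in> Field X" "y \<in> Field (Y x)" for x y
  proof -
    have "baire1 (f (x, 0))" "baire1 (f (x, 1))"
      using f(1) that by (auto simp: Field_duplication)
    then show ?thesis
      unfolding G_def prod.case
      by (intro baire1_add baire1_mult baire1_diff baire1_compose_continuous[OF _ u]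
          baire1_compose_continuous[OF h_baire1[OF that] v])
  qed
  \<comment> \<open>For \<open>x < x'\<close>, the upper function at \<open>x\<close> differs from the lower one at \<open>x'\<close>, since they
    represent different points of the duplication; a gap between them separates the whole of
    \<open>Y x\<close> from the whole of \<open>Y x'\<close>.\<close>
  have G_less: "G (x, y) \<noteq> G (x', y')" if "(x, x') \<in> X" "x \<noteq> x'" for x x' y y'
  proof -
    have xx: "x \<in> Field X" "x' \<in> Field X" using that by (auto intro: FieldI1 FieldI2)
    then have "f (x, 1) \<noteq> f (x', 0)"
      using f(2) that(2) by (auto simp: Field_duplication dest: inj_onD)
    then obtain s where "f (x, 1) s \<noteq> f (x', 0) s" by (auto simp: fun_eq_iff)
    with f10[OF that, of s] have less: "f (x, 1) s < f (x', 0) s" by simp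
    obtain t where "u t = s" using onto by blast
    then have "G (x, y) t < G (x', y') t"
      using less G_le[OF xx(1), of y t] G_ge[OF xx(2), of t y'] by simp
    then show ?thesis by auto
  qed
  have G_inj: "inj_on G (Field (lex_replace X Y))"
  proof (rule inj_onI, clarsimp simp: F)
    fix x y x' y'
    assume x: "x \<in> Field X" "x' \<in> Field X" and y: "y \<in> Field (Y x)" "y' \<in> Field (Y x')"
      and eq: "G (x, y) = G (x', y')"
    have xx: "x = x'"
      using Linear_orderD(4)[OF X x] G_less eq by metis
    have "f (x, 0) \<noteq> f (x, 1)"
      using f(2) x by (auto simp: Field_duplication dest: inj_onD)
    then obtain s where s: "f (x, 0) s \<noteq> f (x, 1) s" by (auto simp: fun_eq_iff)
    \<comment> \<open>On the preimage of the section at \<open>s\<close> the coefficient of \<open>h\<close> is a nonzero constant, and the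
      second coordinate takes every value, so \<open>h\<close> can be recovered.\<close>
    have "h x y b = h x y' b" for b
    proof -
      obtain t where "u t = s" "v t = b" using onto by blast
      then show ?thesis
        using fun_cong[OF eq, of t] s by (simp add: G_def xx)
    qed
    then have "y = y'"
      using h_inj[OF x(1)] y xx by (auto dest: inj_onD)
    with xx show "x = x' \<and> y = y'" by simp
  qed
  have G_mono: "G p \<le> G q" if "(p, q) \<in> lex_replace X Y" for p q
  proof -
    obtain x y x' y' where pq: "p = (x, y)" "q = (x', y')" by fastforce
    show ?thesis
    proof (cases "x = x'")
      case True
      then show ?thesis
        using that pq G_same by (auto simp: lex_replace_def le_fun_def)
    next
      case False
      with that pq have xx: "(x, x') \<in> X" "x \<in> Field X" "x' \<in> Field X"
        by (auto simp: lex_replace_def)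
      have "G (x, y) t \<le> G (x', y') t" for t
        using G_le[OF xx(2), of y t] f10[OF xx(1) False, of "u t"] G_ge[OF xx(3), of t y']
        by linarith
      then show ?thesis by (simp add: pq le_fun_def)
    qed
  qed
  have "\<forall>p\<in>Field (lex_replace X Y). baire1 (G p)"
    using G_baire1 by (auto simp: F)
  with G_inj G_mono show ?thesis
    unfolding representable_iff
    by (intro conjI exI[of _ G] Linear_order_lex_replace[OF X YL]) auto
qed

section \<open>Transfinite induction over the stages\<close>

lemma representable_duplication_Base:
  assumes "Linear_order X" "representable (duplication X)"
  shows "representable (duplication (dir_image X Base))"
proof (rule representable_inj_mono[OF assms(2), where g = "\<lambda>(p, i). (the_inv Base p, i)"])
  have Base: "the_inv Base (Base a) = a" for a :: 'a
    by (rule the_inv_f_f) (simp add: inj_def)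
  show "Linear_order (duplication (dir_image X Base))"
    by (intro Linear_order_duplication Linear_order_dir_image assms(1)) (simp add: inj_on_def)
  show "(\<lambda>(p, i). (the_inv Base p, i)) ` Field (duplication (dir_image X Base))
      \<subseteq> Field (duplication X)"
    by (auto simp: Field_duplication dir_image_Field Base)
  show "inj_on (\<lambda>(p, i). (the_inv Base p, i)) (Field (duplication (dir_image X Base)))"
    by (auto simp: inj_on_def Field_duplication dir_image_Field Base)
  show "((\<lambda>(p, i). (the_inv Base p, i)) p, (\<lambda>(p, i). (the_inv Base p, i)) q) \<in> duplication X"
    if "(p, q) \<in> duplication (dir_image X Base)" for p q
    using that
    by (cases p; cases q)
      (auto simp: in_duplication_iff dir_image_Field Base, auto simp: dir_image_def Base)
qed

lemma Linear_order_replace_points: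
  assumes "Linear_order X" "\<And>x. x \<in> Field X \<Longrightarrow> Linear_order (Y x)"
  shows "Linear_order (replace_points X Y)"
  unfolding replace_points_def
  by (intro Linear_order_dir_image Linear_order_lex_replace assms) (auto simp: inj_on_def)

text \<open>
  Re-bracketing \<open>((x, y), i)\<close> as \<open>(x, (y, i))\<close> turns the duplication of a replacement into a
  replacement by duplications.
\<close>

lemma representable_duplication_replace_points:
  assumes X: "Linear_order X" "representable (duplication X)"
    and Y: "\<And>x. x \<in> Field X \<Longrightarrow> Linear_order (Y x)"
      "\<And>x. x \<in> Field X \<Longrightarrow> representable (duplication (Y x))"
  shows "representable (duplication (replace_points X Y))"
proof -
  let ?R = "replace_points X Y" and ?S = "lex_replace X (\<lambda>x. duplication (Y x))"
  define g :: "'a point \<times> nat \<Rightarrow> 'a point \<times> 'a point \<times> nat"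
    where "g = (\<lambda>(p, i). case p of Pt x y \<Rightarrow> (x, y, i))"
  have g: "g (Pt x y, i) = (x, y, i)" for x y i
    by (simp add: g_def)
  have FR: "Field ?R = (\<lambda>(x, y). Pt x y) ` (SIGMA x:Field X. Field (Y x))"
    unfolding replace_points_def by (simp add: dir_image_Field Field_lex_replace[OF Y(1)])
  have FS: "Field ?S = (SIGMA x:Field X. Field (Y x) \<times> {0, 1})"
    by (subst Field_lex_replace[OF Linear_order_duplication[OF Y(1)]])
      (simp_all add: Field_duplication)
  have S: "representable ?S"
    by (rule representable_lex_replace[OF X Y(2)])
  show ?thesis
  proof (rule representable_inj_mono[OF S, where g = g])
    show "Linear_order (duplication ?R)"
      by (intro Linear_order_duplication Linear_order_replace_points X Y)
    show "g ` Field (duplication ?R) \<subseteq> Field ?S"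
      unfolding Field_duplication FR FS by (force simp: g)
    show "inj_on g (Field (duplication ?R))"
      unfolding Field_duplication FR by (auto simp: inj_on_def g)
    show "(g p, g q) \<in> ?S" if pq: "(p, q) \<in> duplication ?R" for p q
    proof -
      from pq have "p \<in> Field (duplication ?R)" "q \<in> Field (duplication ?R)"
        by (auto intro: FieldI1 FieldI2)
      then obtain x y i x' y' i' where p: "p = (Pt x y, i)" and q: "q = (Pt x' y', i')"
          and mem: "x \<in> Field X" "y \<in> Field (Y x)" "x' \<in> Field X" "y' \<in> Field (Y x')"
            "i \<le> 1" "i' \<le> 1"
        unfolding Field_duplication FR by auto
      then show ?thesis
        using pq
        by (auto simp: p q g in_duplication_iff replace_points_def dir_image_def lex_replace_def
            Field_duplication)
    qed
  qed
qed

lemma representable_duplication_S_stage: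
  fixes H :: "'a rel set" and \<alpha> :: "'i rel"
  assumes "\<And>X. X \<in> H \<Longrightarrow> Linear_order X"
    and "\<And>X. X \<in> H \<Longrightarrow> representable (duplication X)"
    and "R \<in> S_stage H \<alpha>"
  shows "Linear_order R \<and> representable (duplication R)"
  using assms(3)
proof (induction \<alpha> arbitrary: R rule: wf_induct_rule[OF wf_ordLess])
  case (1 \<alpha>)
  show ?case
  proof (cases "\<alpha> = {}")
    case True
    have empty: "Linear_order {}" "representable (duplication {})"
      unfolding representable_iff
      by (simp_all add: duplication_def lex_replace_def case_prod_unfold Field_def order_on_defs)
    have base: "Linear_order (dir_image X Base)" "representable (duplication (dir_image X Base))"
      if "X \<in> H" for X
      using assms(1,2)[OF that] representable_duplication_Base
      by (auto intro!: Linear_order_dir_image simp: inj_on_def)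
    from 1(2) True have "R = {} \<or> (\<exists>X\<in>H. R = dir_image X Base)"
      by (subst (asm) S_stage.simps) auto
    then show ?thesis using empty base by blast
  next
    case False
    define U where "U = (\<Union>\<beta>\<in>{\<beta> :: 'i rel. (\<beta>, \<alpha>) \<in> ordLess}. S_stage H \<beta>)"
    have "S_stage H \<alpha> = {replace_points X Y | X Y. X \<in> U \<and> (\<forall>x\<in>Field X. Y x \<in> U)}"
      unfolding U_def by (subst S_stage.simps) (simp only: False if_False)
    with 1(2) have "R \<in> {replace_points X Y | X Y. X \<in> U \<and> (\<forall>x\<in>Field X. Y x \<in> U)}"
      by (simp only:)
    then obtain X Y where R: "R = replace_points X Y"
      and U: "X \<in> U" "\<And>x. x \<in> Field X \<Longrightarrow> Y x \<in> U"
      by blast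
    have IH: "Linear_order Z" "representable (duplication Z)" if "Z \<in> U" for Z
      using 1(1) that unfolding U_def by blast+
    show ?thesis
      unfolding R using IH U
      by (intro conjI Linear_order_replace_points representable_duplication_replace_points) auto
  qed
qed

theorem theorem3p7:
  fixes H :: "'a rel set"
  assumes "\<And>X. X \<in> H \<Longrightarrow> Linear_order X"
    and "\<And>X. X \<in> H \<Longrightarrow> representable (duplication X)"
  shows "\<forall>T \<in> S_types TYPE('i) H. representable_type T"
proof
  fix T
  assume "T \<in> S_types TYPE('i) H"
  then obtain \<alpha> :: "'i rel" and R where R: "R \<in> S_stage H \<alpha>" "T = order_type R"
    unfolding S_types_def by blast
  have RL: "Linear_order R" "representable (duplication R)"
    using representable_duplication_S_stage[OF assms R(1)] by auto
  have "similar R R"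
    unfolding similar_def by (rule exI[of _ id]) auto
  then have "R \<in> T"
    using RL by (simp add: R order_type_def)
  with representable_of_duplication[OF RL] show "representable_type T"
    unfolding representable_type_def by blast
qed

end
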